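(* Let $n\ge 1$ be an integer, let $\{a_{i,j}\}_{1\le i,j\le n}$ be a collection of any real numbers, and let $\Pi_n$ be a uniformly distributed random permutation of $\{1,\dots,n\}$. Consider $Z_n=\sum_{i=1}^n a_{i,\Pi_n(i)}$. Then, for all $t>0$, $$\mathbb{P}\left(\left|Z_n-\mathbb{E}[Z_n]\right|\ge t\right)\ \le\ 16\,e^{1/16}\exp\left(\frac{-t^2}{256\left(\operatorname{Var}(Z_n)+\max_{1\le i,j\le n}\{|a_{i,j}|\}\,t\right)}\right).$$
   Context: A uniformly distributed random permutation of $\{1,\dots,n\}$ takes each of the $n!$ permutations with probability $1/n!$. *)

theory Defs
  imports "HOL-Probability.Probability" "HOL-Combinatorics.Permutations"
begin

text \<open>
  Permutations of \<open>{1..n}\<close> are represented by \<open>permutes\<close>, that is, as functions on \<open>nat\<close>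
  that are the identity outside \<open>{1..n}\<close>; there are exactly \<open>n!\<close> of them. Measurability into
  the count space forces every value on \<open>space M\<close> to be such a permutation.
\<close>

definition uniform_random_permutation ::
    "'w measure \<Rightarrow> nat \<Rightarrow> ('w \<Rightarrow> nat \<Rightarrow> nat) \<Rightarrow> bool" where
  "uniform_random_permutation M n P \<longleftrightarrow>
     P \<in> measurable M (count_space {\<pi>. \<pi> permutes {1..n}}) \<and>
     (\<forall>\<pi>. \<pi> permutes {1..n} \<longrightarrow> measure M {\<omega> \<in> space M. P \<omega> = \<pi>} = 1 / fact n)"

end

theory Submission
  imports Defs
begin

text \<open>
  The proof is the exchangeable pair method of Stein and Chatterjee, in a form that controls the
  moment generating function by the variance.

  Subtracting row and column means replaces \<open>Z - E Z\<close> by \<open>W p = (\<Sum>i. d i (p i))\<close> for an array \<open>d\<close>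
  with vanishing row and column sums. Let \<open>W'\<close> be the value of \<open>W\<close> after exchanging the values of
  \<open>p\<close> at \<open>i\<close> and \<open>j\<close>. Since \<open>d\<close> is centred, the differences \<open>W - W'\<close> add up over all pairs
  \<open>i, j\<close> to exactly \<open>2 n W\<close>, and since exchanging preserves the uniform distribution while
  reversing the sign of \<open>W - W'\<close>, this gives
  \<open>4 n E (W f(W)) = (\<Sum>i j. E ((W - W') (f(W) - f(W'))))\<close> for every \<open>f\<close> (lemma \<open>exchangeable_pair\<close>).
  It is used twice.

  With \<open>f(w) = w\<close> it expresses the variance \<open>V\<close> of \<open>W\<close> through the squares of the differences. A
  lower bound for these, valid for every permutation, yields \<open>Q \<le> 2 n V\<close>, where \<open>Q\<close> is the
  sum of all squared entries of \<open>d\<close> (lemma \<open>Q_le_variance\<close>).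

  With \<open>f(w) = exp (\<theta> w)\<close> the left-hand side is, up to the factor, the derivative of the moment
  generating function \<open>m\<close>, and the right-hand side is at most
  \<open>16 \<theta> E ((n S + Q) exp (\<theta> W))\<close>, where \<open>S\<close> is the sum of the \<open>n\<close> squared entries that \<open>p\<close> selects. The
  random factor \<open>S\<close> is removed by resampling: averaging over \<open>j\<close> the exchange of \<open>i\<close> and \<open>j\<close> replaces
  \<open>n S\<close> by the constant \<open>Q\<close> and changes \<open>exp (\<theta> W)\<close> by a factor of at most \<open>exp (\<theta> b)\<close>, where \<open>b\<close> is four times
  the largest \<open>\<bar>a i j\<bar>\<close> (lemma \<open>decoupling\<close>). Together these give
  \<open>m'(\<theta>) \<le> 8 \<theta> (1 + exp (\<theta> b)) V m(\<theta>)\<close>, hence \<open>m(\<theta>) \<le> exp (12 V \<theta>\<^sup>2)\<close> as long as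
  \<open>\<theta> b \<le> 1/4\<close>. Markov's inequality then bounds each tail by \<open>exp (- t\<^sup>2 / (64 (V + b t / 4)))\<close>,
  which is stronger than what is claimed.
\<close>

section \<open>Averages over permutations\<close>

definition perm_mean :: "'a set \<Rightarrow> (('a \<Rightarrow> 'a) \<Rightarrow> real) \<Rightarrow> real" where
  "perm_mean I F = (\<Sum>p | p permutes I. F p) / fact (card I)"

lemma perm_mean_sum: "perm_mean I (\<lambda>p. \<Sum>x\<in>A. F x p) = (\<Sum>x\<in>A. perm_mean I (F x))"
  unfolding perm_mean_def by (subst sum.swap) (simp add: sum_divide_distrib)

lemma perm_mean_add: "perm_mean I (\<lambda>p. F p + G p) = perm_mean I F + perm_mean I G"
  by (simp add: perm_mean_def sum.distrib add_divide_distrib)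

lemma perm_mean_diff: "perm_mean I (\<lambda>p. F p - G p) = perm_mean I F - perm_mean I G"
  by (simp add: perm_mean_def sum_subtractf diff_divide_distrib)

lemma perm_mean_cmult: "perm_mean I (\<lambda>p. c * F p) = c * perm_mean I F"
  by (simp add: perm_mean_def sum_distrib_left)

lemma perm_mean_const: "finite I \<Longrightarrow> perm_mean I (\<lambda>p. c) = c"
  by (simp add: perm_mean_def card_permutations)

lemma perm_mean_mono:
  "(\<And>p. p permutes I \<Longrightarrow> F p \<le> G p) \<Longrightarrow> perm_mean I F \<le> perm_mean I G"
  by (auto simp: perm_mean_def intro!: divide_right_mono sum_mono)

lemma perm_mean_cong:
  "(\<And>p. p permutes I \<Longrightarrow> F p = G p) \<Longrightarrow> perm_mean I F = perm_mean I G"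
  by (simp add: perm_mean_def)

lemma perm_mean_nonneg:
  "(\<And>p. p permutes I \<Longrightarrow> 0 \<le> F p) \<Longrightarrow> 0 \<le> perm_mean I F"
  unfolding perm_mean_def by (intro divide_nonneg_nonneg sum_nonneg) auto

lemma perm_mean_transpose:
  assumes "i \<in> I" "j \<in> I"
  shows "perm_mean I (\<lambda>p. F (p \<circ> Transposition.transpose i j)) = perm_mean I F"
proof -
  have perm: "p \<circ> Transposition.transpose i j permutes I" if "p permutes I" for p
    using that assms by (intro permutes_compose permutes_swap_id)
  have "(\<Sum>p | p permutes I. F (p \<circ> Transposition.transpose i j)) = (\<Sum>p | p permutes I. F p)"
    by (rule sum.reindex_bij_witness[where i = "\<lambda>p. p \<circ> Transposition.transpose i j"
          and j = "\<lambda>p. p \<circ> Transposition.transpose i j"])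
      (auto simp: perm comp_assoc)
  then show ?thesis
    by (simp add: perm_mean_def)
qed

text \<open>
  The value \<open>p i\<close> may be replaced by \<open>p j\<close> for every \<open>j\<close> without changing the mean, provided that the other factor
  sees the exchanged permutation. For fixed \<open>i\<close>, the sum over \<open>j\<close> then ranges over the whole \<open>i\<close>-th row of
  \<open>g\<close>, so that the dependence of the first factor on \<open>p\<close> disappears.
\<close>

lemma perm_mean_resample:
  assumes "finite I"
  shows "card I * perm_mean I (\<lambda>p. (\<Sum>i\<in>I. g i (p i)) * F p)
    = (\<Sum>i\<in>I. \<Sum>j\<in>I. perm_mean I (\<lambda>p. g i (p j) * F (p \<circ> Transposition.transpose i j)))"
proof -
  have "perm_mean I (\<lambda>p. g i (p j) * F (p \<circ> Transposition.transpose i j)) = perm_mean I (\<lambda>p. g i (p i) * F p)"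
    if "i \<in> I" "j \<in> I" for i j
    using perm_mean_transpose[OF that, of "\<lambda>p. g i (p i) * F p"] by simp
  then show ?thesis
    by (simp add: sum_distrib_right perm_mean_sum flip: sum_distrib_left)
qed

text \<open>
  Convexity would give half of the right-hand side. The symmetric form matters more than the
  constant: both exponentials have the same mean when \<open>x\<close> and \<open>y\<close> are exchangeable.
\<close>

lemma mult_diff_exp_le:
  fixes x y \<theta> :: real
  assumes "0 \<le> \<theta>"
  shows "(x - y) * (exp (\<theta> * x) - exp (\<theta> * y)) \<le> \<theta> * ((x - y)\<^sup>2 * (exp (\<theta> * x) + exp (\<theta> * y)))"
proof -
  have one: "(x - y) * (exp (\<theta> * x) - exp (\<theta> * y)) \<le> \<theta> * ((x - y)\<^sup>2 * (exp (\<theta> * x) + exp (\<theta> * y)))"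
    if "y \<le> x" for x y
  proof -
    have "1 - \<theta> * (x - y) \<le> exp (- (\<theta> * (x - y)))"
      using exp_ge_add_one_self[of "- (\<theta> * (x - y))"] by simp
    then have "(1 - \<theta> * (x - y)) * exp (\<theta> * x) \<le> exp (- (\<theta> * (x - y))) * exp (\<theta> * x)"
      by (intro mult_right_mono) auto
    also have "\<dots> = exp (\<theta> * y)"
      by (simp add: algebra_simps flip: exp_add)
    finally have "exp (\<theta> * x) - exp (\<theta> * y) \<le> \<theta> * (x - y) * exp (\<theta> * x)"
      by (simp add: algebra_simps)
    also have "\<dots> \<le> \<theta> * (x - y) * (exp (\<theta> * x) + exp (\<theta> * y))"
      using that assms by (intro mult_left_mono) auto
    finally have "(x - y) * (exp (\<theta> * x) - exp (\<theta> * y))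
        \<le> (x - y) * (\<theta> * (x - y) * (exp (\<theta> * x) + exp (\<theta> * y)))"
      using that by (intro mult_left_mono) auto
    then show ?thesis
      by (simp add: power2_eq_square mult_ac)
  qed
  show ?thesis
    using one[of x y] one[of y x]
    by (cases "y \<le> x") (auto simp: algebra_simps power2_commute)
qed

lemma exp_quarter_le: "exp (1 / 4 :: real) \<le> 2"
  using exp_bound[of "1/4"] by (simp add: power2_eq_square)

section \<open>Doubly centred arrays\<close>

text \<open>
  Subtracting row and column means turns \<open>a\<close> into an array \<open>d\<close> whose rows and columns sum to zero,
  at the price of entries that may be larger than those of \<open>a\<close>. Besides the variance, the tail
  bound depends only on how much the permuted sum changes when two values of the permutation are
  exchanged, and centring does not affect that change. This is why \<open>b\<close> bounds the exchange increments and not the entries.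
\<close>

locale centred_array =
  fixes I :: "'a set" and d :: "'a \<Rightarrow> 'a \<Rightarrow> real" and b :: real
  assumes finite_index: "finite I"
    and nonempty_index: "I \<noteq> {}"
    and row_sum: "i \<in> I \<Longrightarrow> (\<Sum>j\<in>I. d i j) = 0"
    and column_sum: "j \<in> I \<Longrightarrow> (\<Sum>i\<in>I. d i j) = 0"
    and increment_bound:
      "\<lbrakk>i \<in> I; j \<in> I; k \<in> I; l \<in> I\<rbrakk> \<Longrightarrow> \<bar>d i k + d j l - d i l - d j k\<bar> \<le> b"
begin

definition W :: "('a \<Rightarrow> 'a) \<Rightarrow> real" where
  "W p = (\<Sum>i\<in>I. d i (p i))"

definition S :: "('a \<Rightarrow> 'a) \<Rightarrow> real" where
  "S p = (\<Sum>i\<in>I. (d i (p i))\<^sup>2)"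

definition Q :: real where
  "Q = (\<Sum>i\<in>I. \<Sum>j\<in>I. (d i j)\<^sup>2)"

definition increment :: "'a \<Rightarrow> 'a \<Rightarrow> ('a \<Rightarrow> 'a) \<Rightarrow> real" where
  "increment i j p = d i (p i) + d j (p j) - d i (p j) - d j (p i)"

definition mgf :: "real \<Rightarrow> real" where
  "mgf \<theta> = perm_mean I (\<lambda>p. exp (\<theta> * W p))"

lemma card_pos: "0 < real (card I)"
  using finite_index nonempty_index by (simp add: card_gt_0_iff)

lemma bound_nonneg: "0 \<le> b"
  using nonempty_index increment_bound by fastforce

lemma sum_perm: "p permutes I \<Longrightarrow> (\<Sum>j\<in>I. f (p j)) = (\<Sum>j\<in>I. f j)"
  by (rule sum.reindex_bij_betw) (rule permutes_imp_bij)

lemma W_diff_transpose: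
  assumes "i \<in> I" "j \<in> I"
  shows "W p - W (p \<circ> Transposition.transpose i j) = increment i j p"
proof (cases "i = j")
  case True
  then show ?thesis by (simp add: increment_def)
next
  case False
  have "W p - W (p \<circ> Transposition.transpose i j) = (\<Sum>k\<in>I. d k (p k) - d k (p (Transposition.transpose i j k)))"
    by (simp add: W_def sum_subtractf)
  also have "\<dots> = (\<Sum>k\<in>{i,j}. d k (p k) - d k (p (Transposition.transpose i j k)))"
    using assms finite_index by (intro sum.mono_neutral_right) (auto simp: Transposition.transpose_def)
  also have "\<dots> = increment i j p"
    using False by (simp add: increment_def)
  finally show ?thesis .
qed

lemma increment_transpose: "increment i j (p \<circ> Transposition.transpose i j) = - increment i j p"
  by (simp add: increment_def)

text \<open>
  The exchanges act on \<open>W\<close> as a contraction: an average exchange moves \<open>W\<close> towards zero by \<open>2 W / n\<close>.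
  The terms with \<open>d i (p j)\<close> disappear because \<open>d\<close> is centred.
\<close>

lemma sum_increment:
  assumes p: "p permutes I"
  shows "(\<Sum>i\<in>I. \<Sum>j\<in>I. increment i j p) = 2 * card I * W p"
proof -
  have r: "(\<Sum>i\<in>I. \<Sum>j\<in>I. d i (p j)) = 0"
    using sum_perm[OF p, of "d _"] row_sum by simp
  then have c: "(\<Sum>i\<in>I. \<Sum>j\<in>I. d j (p i)) = 0"
    by (subst sum.swap) 
  show ?thesis
    by (simp add: increment_def sum.distrib sum_subtractf r c W_def flip: sum_distrib_left)
qed

text \<open>
  After \<open>sum_increment\<close>, each term \<open>increment i j p * f (W p)\<close> is antisymmetrised: exchanging \<open>p i\<close>
  and \<open>p j\<close> changes the sign of the increment and preserves the mean.
\<close>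

lemma exchangeable_pair:
  "4 * card I * perm_mean I (\<lambda>p. W p * f (W p)) = (\<Sum>i\<in>I. \<Sum>j\<in>I. 
     perm_mean I (\<lambda>p. increment i j p * (f (W p) - f (W (p \<circ> Transposition.transpose i j)))))"
proof -
  have half: "perm_mean I (\<lambda>p. increment i j p * (f (W p) - f (W (p \<circ> Transposition.transpose i j))))
      = 2 * perm_mean I (\<lambda>p. increment i j p * f (W p))" if "i \<in> I" "j \<in> I" for i j
  proof -
    have "perm_mean I (\<lambda>p. - (increment i j p * f (W (p \<circ> Transposition.transpose i j))))
        = perm_mean I (\<lambda>p. increment i j p * f (W p))"
      using perm_mean_transpose[OF that, of "\<lambda>p. increment i j p * f (W p)"]
      by (simp add: increment_transpose)
    then show ?thesis
      using perm_mean_add[of I "\<lambda>p. increment i j p * f (W p)"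
          "\<lambda>p. - (increment i j p * f (W (p \<circ> Transposition.transpose i j)))"]
      by (simp add: algebra_simps)
  qed
  have "4 * card I * perm_mean I (\<lambda>p. W p * f (W p))
      = 2 * perm_mean I (\<lambda>p. (2 * card I * W p) * f (W p))"
    by (simp add: perm_mean_cmult mult.assoc)
  also have "\<dots> = 2 * perm_mean I (\<lambda>p. (\<Sum>i\<in>I. \<Sum>j\<in>I. increment i j p) * f (W p))"
    using sum_increment by (intro arg_cong[of _ _ "\<lambda>x. 2 * x"] perm_mean_cong) simp
  also have "\<dots> = (\<Sum>i\<in>I. \<Sum>j\<in>I. 2 * perm_mean I (\<lambda>p. increment i j p * f (W p)))"
    by (simp add: sum_distrib_right perm_mean_sum sum_distrib_left)
  finally show ?thesis
    using half by simp
qed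

lemma perm_mean_W: "perm_mean I W = 0"
  using exchangeable_pair[of "\<lambda>_. 1"] card_pos by (simp add: perm_mean_def)

lemma double_sum_permuted_squares:
  assumes p: "p permutes I"
  shows "(\<Sum>i\<in>I. \<Sum>j\<in>I. (d i (p j))\<^sup>2) = Q" "(\<Sum>i\<in>I. \<Sum>j\<in>I. (d j (p i))\<^sup>2) = Q"
proof -
  show *: "(\<Sum>i\<in>I. \<Sum>j\<in>I. (d i (p j))\<^sup>2) = Q"
    unfolding Q_def by (intro sum.cong refl sum_perm p)
  then show "(\<Sum>i\<in>I. \<Sum>j\<in>I. (d j (p i))\<^sup>2) = Q"
    by (subst sum.swap)
qed

lemma sum_increment_sq_le:
  assumes p: "p permutes I"
  shows "(\<Sum>i\<in>I. \<Sum>j\<in>I. (increment i j p)\<^sup>2) \<le> 8 * (card I * S p + Q)"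
proof -
  have four: "(u + v - w - z)\<^sup>2 \<le> 4 * (u\<^sup>2 + v\<^sup>2 + w\<^sup>2 + z\<^sup>2)" for u v w z :: real
  proof -
    have "4 * (u\<^sup>2 + v\<^sup>2 + w\<^sup>2 + z\<^sup>2) - (u + v - w - z)\<^sup>2
      = (u - v)\<^sup>2 + (u + w)\<^sup>2 + (u + z)\<^sup>2 + (v + w)\<^sup>2 + (v + z)\<^sup>2 + (w - z)\<^sup>2"
      by (simp add: power2_eq_square algebra_simps)
    also have "\<dots> \<ge> 0" by simp
    finally show ?thesis by linarith
  qed
  have "(\<Sum>i\<in>I. \<Sum>j\<in>I. (increment i j p)\<^sup>2)
      \<le> (\<Sum>i\<in>I. \<Sum>j\<in>I. 4 * ((d i (p i))\<^sup>2 + (d j (p j))\<^sup>2 + (d i (p j))\<^sup>2 + (d j (p i))\<^sup>2))"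
    unfolding increment_def by (intro sum_mono four)
  also have "\<dots> = 8 * (card I * S p + Q)"
    using double_sum_permuted_squares[OF p]
    by (simp add: sum.distrib S_def flip: sum_distrib_left)
  finally show ?thesis .
qed

text \<open>
  Dropping the nonnegative square of \<open>d i (p j) + d j (p i)\<close> from each squared increment leaves
  terms that can be summed exactly: the mixed products vanish because \<open>d\<close> is centred, and the
  products \<open>d i (p i) * d j (p j)\<close> add up to \<open>(W p)\<^sup>2\<close>. No joint distribution of several values of
  the permutation has to be computed.
\<close>

lemma sum_increment_sq_ge:
  assumes p: "p permutes I"
  shows "2 * card I * S p \<le> (\<Sum>i\<in>I. \<Sum>j\<in>I. (increment i j p)\<^sup>2)"
proof -
  define x where "x i = d i (p i)" for i
  define y where "y i j = d i (p j)" for i j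
  have rows: "(\<Sum>j\<in>I. y i j) = 0" if "i \<in> I" for i
    using sum_perm[OF p, of "d i"] row_sum[OF that] by (simp add: y_def)
  have cols: "(\<Sum>i\<in>I. y i j) = 0" if "j \<in> I" for j
    using column_sum permutes_in_image[OF p] that by (simp add: y_def)
  have lower: "(x i)\<^sup>2 + (x j)\<^sup>2 + 2 * (x i * x j) - 2 * (x i * y i j) - 2 * (x i * y j i)
      - 2 * (x j * y i j) - 2 * (x j * y j i) \<le> (increment i j p)\<^sup>2" for i j
  proof -
    have "(increment i j p)\<^sup>2 - ((x i)\<^sup>2 + (x j)\<^sup>2 + 2 * (x i * x j) - 2 * (x i * y i j)
        - 2 * (x i * y j i) - 2 * (x j * y i j) - 2 * (x j * y j i)) = (y i j + y j i)\<^sup>2"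
      by (simp add: increment_def x_def y_def power2_eq_square algebra_simps)
    also have "\<dots> \<ge> 0" by simp
    finally show ?thesis by linarith
  qed
  have xx: "(\<Sum>i\<in>I. \<Sum>j\<in>I. 2 * (x i * x j)) = 2 * (W p)\<^sup>2"
    by (simp add: W_def x_def power2_eq_square flip: sum_distrib_left sum_distrib_right)
  have xy: "(\<Sum>i\<in>I. \<Sum>j\<in>I. 2 * (x i * y i j)) = 0" "(\<Sum>i\<in>I. \<Sum>j\<in>I. 2 * (x i * y j i)) = 0"
    using rows cols by (simp_all flip: sum_distrib_left)
  then have yx: "(\<Sum>i\<in>I. \<Sum>j\<in>I. 2 * (x j * y j i)) = 0" "(\<Sum>i\<in>I. \<Sum>j\<in>I. 2 * (x j * y i j)) = 0"
    by (subst sum.swap; simp)+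
  have "2 * card I * S p \<le> 2 * card I * S p + 2 * (W p)\<^sup>2"
    by simp
  also have "\<dots> = (\<Sum>i\<in>I. \<Sum>j\<in>I. (x i)\<^sup>2 + (x j)\<^sup>2 + 2 * (x i * x j) - 2 * (x i * y i j)
      - 2 * (x i * y j i) - 2 * (x j * y i j) - 2 * (x j * y j i))"
    by (simp only: sum.distrib sum_subtractf xx xy yx)
      (simp add: S_def x_def flip: sum_distrib_left)
  also have "\<dots> \<le> (\<Sum>i\<in>I. \<Sum>j\<in>I. (increment i j p)\<^sup>2)"
    by (intro sum_mono lower)
  finally show ?thesis .
qed

lemma perm_mean_S: "card I * perm_mean I S = Q"
proof -
  have "card I * perm_mean I S = perm_mean I (\<lambda>p. \<Sum>i\<in>I. \<Sum>j\<in>I. (d i (p j))\<^sup>2)"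
    using perm_mean_resample[OF finite_index, of "\<lambda>i k. (d i k)\<^sup>2" "\<lambda>_. 1"]
    by (simp add: S_def[abs_def] perm_mean_sum)
  also have "\<dots> = perm_mean I (\<lambda>_. Q)"
    by (intro perm_mean_cong double_sum_permuted_squares)
  finally show ?thesis
    by (simp add: perm_mean_const finite_index)
qed

text \<open>
  The sharp relation has \<open>card I - 1\<close> in place of \<open>2 * card I\<close>. The weaker factor comes from the
  terms dropped in \<open>sum_increment_sq_ge\<close>.
\<close>

lemma Q_le_variance: "Q \<le> 2 * card I * perm_mean I (\<lambda>p. (W p)\<^sup>2)"
proof -
  have "2 * Q = 2 * card I * perm_mean I S"
    by (simp flip: perm_mean_S)
  also have "\<dots> = perm_mean I (\<lambda>p. 2 * card I * S p)"
    by (simp add: perm_mean_cmult)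
  also have "\<dots> \<le> perm_mean I (\<lambda>p. \<Sum>i\<in>I. \<Sum>j\<in>I. (increment i j p)\<^sup>2)"
    by (intro perm_mean_mono sum_increment_sq_ge)
  also have "\<dots> = 4 * card I * perm_mean I (\<lambda>p. (W p)\<^sup>2)"
    using exchangeable_pair[of "\<lambda>x. x"]
    by (simp add: perm_mean_sum W_diff_transpose power2_eq_square)
  finally show ?thesis by simp
qed

text \<open>
  For single permutations \<open>S p\<close> can be far above its mean \<open>Q / n\<close>, so a bound valid for every \<open>p\<close>
  would lose the variance. Resampling averages it out instead, because a single
  exchange changes the exponent by at most \<open>\<theta> * b\<close>.
\<close>

lemma decoupling:
  assumes \<theta>: "0 \<le> \<theta>"
  shows "card I * perm_mean I (\<lambda>p. S p * exp (\<theta> * W p)) \<le> exp (\<theta> * b) * Q * mgf \<theta>"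
proof -
  have "card I * perm_mean I (\<lambda>p. S p * exp (\<theta> * W p))
    = (\<Sum>i\<in>I. \<Sum>j\<in>I. perm_mean I (\<lambda>p. (d i (p j))\<^sup>2 * exp (\<theta> * W (p \<circ> Transposition.transpose i j))))"
    unfolding S_def using perm_mean_resample[OF finite_index, of "\<lambda>i k. (d i k)\<^sup>2"] .
  also have "\<dots> \<le> (\<Sum>i\<in>I. \<Sum>j\<in>I. perm_mean I (\<lambda>p. (d i (p j))\<^sup>2 * exp (\<theta> * b + \<theta> * W p)))"
  proof (intro sum_mono perm_mean_mono mult_left_mono)
    fix i j p assume *: "i \<in> I" "j \<in> I" "p permutes I"
    then have "\<bar>increment i j p\<bar> \<le> b"
      unfolding increment_def by (intro increment_bound) (simp_all add: permutes_in_image)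
    then have "W (p \<circ> Transposition.transpose i j) \<le> b + W p"
      using W_diff_transpose[OF *(1,2), of p] by linarith
    then have "\<theta> * W (p \<circ> Transposition.transpose i j) \<le> \<theta> * (b + W p)"
      using \<theta> by (rule mult_left_mono)
    then show "exp (\<theta> * W (p \<circ> Transposition.transpose i j)) \<le> exp (\<theta> * b + \<theta> * W p)"
      by (simp add: algebra_simps)
  qed simp
  also have "\<dots> = perm_mean I (\<lambda>p. (\<Sum>i\<in>I. \<Sum>j\<in>I. (d i (p j))\<^sup>2) * exp (\<theta> * b + \<theta> * W p))"
    by (simp add: perm_mean_sum sum_distrib_right)
  also have "\<dots> = perm_mean I (\<lambda>p. (exp (\<theta> * b) * Q) * exp (\<theta> * W p))"
    by (intro perm_mean_cong) (simp add: double_sum_permuted_squares exp_add)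
  also have "\<dots> = exp (\<theta> * b) * Q * mgf \<theta>"
    by (simp only: perm_mean_cmult mgf_def)
  finally show ?thesis .
qed

lemma mgf_deriv: "(mgf has_real_derivative perm_mean I (\<lambda>p. W p * exp (\<theta> * W p))) (at \<theta>)"
  unfolding mgf_def perm_mean_def
  by (auto intro!: derivative_eq_intros sum.cong simp: mult_ac)

lemma mgf_nonneg: "0 \<le> mgf \<theta>"
  unfolding mgf_def by (rule perm_mean_nonneg) simp

lemma mgf_0: "mgf 0 = 1"
  by (simp add: mgf_def perm_mean_const finite_index)

text \<open>The left-hand side is the derivative of \<open>mgf\<close> at \<open>\<theta>\<close>, by \<open>mgf_deriv\<close>.\<close>

lemma mgf_differential_inequality:
  assumes \<theta>: "0 \<le> \<theta>"
  shows "perm_mean I (\<lambda>p. W p * exp (\<theta> * W p))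
    \<le> 8 * \<theta> * (1 + exp (\<theta> * b)) * perm_mean I (\<lambda>p. (W p)\<^sup>2) * mgf \<theta>"
proof -
  let ?e = "\<lambda>p. exp (\<theta> * W p)"
  have pair: "perm_mean I (\<lambda>p. increment i j p * (?e p - ?e (p \<circ> Transposition.transpose i j)))
      \<le> 2 * \<theta> * perm_mean I (\<lambda>p. (increment i j p)\<^sup>2 * ?e p)" if ij: "i \<in> I" "j \<in> I" for i j
  proof -
    have "perm_mean I (\<lambda>p. increment i j p * (?e p - ?e (p \<circ> Transposition.transpose i j)))
        \<le> perm_mean I (\<lambda>p. \<theta> * ((increment i j p)\<^sup>2 * (?e p + ?e (p \<circ> Transposition.transpose i j))))"
      unfolding W_diff_transpose[OF ij, symmetric]
      by (intro perm_mean_mono mult_diff_exp_le \<theta>)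
    also have "\<dots> = \<theta> * (perm_mean I (\<lambda>p. (increment i j p)\<^sup>2 * ?e p)
        + perm_mean I (\<lambda>p. (increment i j p)\<^sup>2 * ?e (p \<circ> Transposition.transpose i j)))"
      by (simp add: perm_mean_cmult distrib_left perm_mean_add)
    also have "perm_mean I (\<lambda>p. (increment i j p)\<^sup>2 * ?e (p \<circ> Transposition.transpose i j))
        = perm_mean I (\<lambda>p. (increment i j p)\<^sup>2 * ?e p)"
      using perm_mean_transpose[OF ij, of "\<lambda>p. (increment i j p)\<^sup>2 * ?e p"]
      by (simp add: increment_transpose)
    finally show ?thesis by (simp add: comp_def mult_ac)
  qed
  have "4 * card I * perm_mean I (\<lambda>p. W p * ?e p)
      \<le> (\<Sum>i\<in>I. \<Sum>j\<in>I. 2 * \<theta> * perm_mean I (\<lambda>p. (increment i j p)\<^sup>2 * ?e p))"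
    unfolding exchangeable_pair[of "\<lambda>x. exp (\<theta> * x)"] by (intro sum_mono pair)
  also have "\<dots> = 2 * \<theta> * perm_mean I (\<lambda>p. (\<Sum>i\<in>I. \<Sum>j\<in>I. (increment i j p)\<^sup>2) * ?e p)"
    by (simp add: sum_distrib_left sum_distrib_right perm_mean_sum)
  also have "\<dots> \<le> 2 * \<theta> * perm_mean I (\<lambda>p. 8 * (card I * S p + Q) * ?e p)"
    using \<theta> by (intro mult_left_mono perm_mean_mono mult_right_mono sum_increment_sq_le) auto
  also have "perm_mean I (\<lambda>p. 8 * (card I * S p + Q) * ?e p)
      = 8 * (card I * perm_mean I (\<lambda>p. S p * ?e p) + Q * mgf \<theta>)"
    unfolding mgf_def
    by (simp add: distrib_left distrib_right perm_mean_add perm_mean_cmult mult.assoc)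
  also have "2 * \<theta> * (8 * (card I * perm_mean I (\<lambda>p. S p * ?e p) + Q * mgf \<theta>))
      \<le> 2 * \<theta> * (8 * (exp (\<theta> * b) * Q * mgf \<theta> + Q * mgf \<theta>))"
    using \<theta> decoupling[OF \<theta>] by (intro mult_left_mono add_right_mono) auto
  also have "\<dots> = 16 * \<theta> * (1 + exp (\<theta> * b)) * mgf \<theta> * Q"
    by (simp add: algebra_simps)
  also have "\<dots> \<le> 16 * \<theta> * (1 + exp (\<theta> * b)) * mgf \<theta> * (2 * card I * perm_mean I (\<lambda>p. (W p)\<^sup>2))"
    using \<theta> by (intro mult_left_mono Q_le_variance mult_nonneg_nonneg mgf_nonneg) auto
  finally have "(4 * card I) * perm_mean I (\<lambda>p. W p * ?e p)
    \<le> (4 * card I) * (8 * \<theta> * (1 + exp (\<theta> * b)) * perm_mean I (\<lambda>p. (W p)\<^sup>2) * mgf \<theta>)"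
    by (simp add: algebra_simps)
  then show ?thesis
    using card_pos by (simp only: mult_le_cancel_left_pos)
qed

text \<open>
  For \<open>\<theta> * b \<le> 1 / 4\<close> the factor \<open>1 + exp (\<theta> * b)\<close> is at most 3, so the logarithmic derivative of
  \<open>mgf\<close> is at most \<open>24 * \<theta> * V\<close>; integrating from 0 gives the exponent. The integration is carried
  out as monotonicity of the quotient of the two sides.
\<close>

lemma mgf_bound:
  assumes \<theta>: "0 \<le> \<theta>" and small: "\<theta> * b \<le> 1 / 4"
  shows "mgf \<theta> \<le> exp (12 * perm_mean I (\<lambda>p. (W p)\<^sup>2) * \<theta>\<^sup>2)"
proof -
  define V where "V = perm_mean I (\<lambda>p. (W p)\<^sup>2)"
  have V: "0 \<le> V"
    unfolding V_def by (rule perm_mean_nonneg) simp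
  let ?m' = "\<lambda>x. perm_mean I (\<lambda>p. W p * exp (x * W p))"
  have "mgf \<theta> * exp (- (12 * V * \<theta>\<^sup>2)) \<le> mgf 0 * exp (- (12 * V * 0\<^sup>2))"
  proof (rule DERIV_nonpos_imp_nonincreasing[OF \<theta>])
    fix x assume x: "0 \<le> x" "x \<le> \<theta>"
    have "x * b \<le> 1 / 4"
      using mult_right_mono[OF x(2) bound_nonneg] small by linarith
    then have "exp (x * b) \<le> 2"
      using exp_quarter_le by (meson exp_le_cancel_iff order_trans)
    then have exp_le: "1 + exp (x * b) \<le> 3"
      by simp
    have "?m' x \<le> 8 * x * (1 + exp (x * b)) * V * mgf x"
      using mgf_differential_inequality[OF x(1)] unfolding V_def .
    also have "\<dots> \<le> 8 * x * 3 * V * mgf x"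
      using x V mgf_nonneg exp_le by (intro mult_right_mono mult_left_mono) auto
    finally have le: "?m' x \<le> 24 * x * V * mgf x"
      by simp
    have "((\<lambda>x. mgf x * exp (- (12 * V * x\<^sup>2))) has_real_derivative
        (?m' x - 24 * x * V * mgf x) * exp (- (12 * V * x\<^sup>2))) (at x)"
      by (auto intro!: derivative_eq_intros mgf_deriv simp: algebra_simps)
    moreover have "(?m' x - 24 * x * V * mgf x) * exp (- (12 * V * x\<^sup>2)) \<le> 0"
      using le by (intro mult_nonpos_nonneg) auto
    ultimately show "\<exists>y. ((\<lambda>x. mgf x * exp (- (12 * V * x\<^sup>2))) has_real_derivative y) (at x) \<and> y \<le> 0"
      by blast
  qed
  then show ?thesis
    by (simp add: mgf_0 exp_minus field_simps flip: V_def)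
qed

lemma upper_tail:
  assumes t: "0 < t"
  shows "perm_mean I (\<lambda>p. of_bool (t \<le> W p))
    \<le> exp (- t\<^sup>2 / (64 * (perm_mean I (\<lambda>p. (W p)\<^sup>2) + b / 4 * t)))"
proof -
  define V where "V = perm_mean I (\<lambda>p. (W p)\<^sup>2)"
  define D where "D = V + b / 4 * t"
  have V: "0 \<le> V"
    unfolding V_def by (rule perm_mean_nonneg) simp
  have b: "0 \<le> b / 4 * t"
    using bound_nonneg t by simp
  show ?thesis
  proof (cases "D = 0")
    case True
    (* Division by zero makes the exponent 0, so the trivial bound by 1 suffices. *)
    have "perm_mean I (\<lambda>p. of_bool (t \<le> W p)) \<le> perm_mean I (\<lambda>_. 1)"
      by (intro perm_mean_mono) auto
    then show ?thesis
      using True by (simp add: perm_mean_const finite_index D_def V_def)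
  next
    case False
    then have D: "0 < D"
      using V b by (simp add: D_def)
    (* The denominator D makes \<theta> * b \<le> 1/4 and at the same time keeps 12 * V * \<theta>^2 at most
       3/4 of \<theta> * t, so that \<theta> * t / 4 = t^2 / (64 * D) survives in the exponent. *)
    define \<theta> where "\<theta> = t / (16 * D)"
    have \<theta>: "0 \<le> \<theta>"
      using t D by (simp add: \<theta>_def)
    have "b * t \<le> 4 * D"
      using V by (simp add: D_def)
    then have small: "\<theta> * b \<le> 1 / 4"
      using D by (simp add: \<theta>_def field_simps)
    have "of_bool (t \<le> W p) \<le> exp (- (\<theta> * t)) * exp (\<theta> * W p)" for p
      using mult_left_mono[OF _ \<theta>, of t "W p"] by (simp flip: exp_add)
    then have "perm_mean I (\<lambda>p. of_bool (t \<le> W p)) \<le> exp (- (\<theta> * t)) * mgf \<theta>"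
      unfolding mgf_def perm_mean_cmult[symmetric] by (intro perm_mean_mono)
    also have "\<dots> \<le> exp (- (\<theta> * t)) * exp (12 * V * \<theta>\<^sup>2)"
      using mgf_bound[OF \<theta> small] by (intro mult_left_mono) (auto simp: V_def)
    also have "\<dots> = exp (12 * V * \<theta>\<^sup>2 - \<theta> * t)"
      by (simp flip: exp_add)
    also have "\<dots> \<le> exp (- t\<^sup>2 / (64 * D))"
    proof -
      have "12 * V * \<theta>\<^sup>2 \<le> 12 * D * \<theta>\<^sup>2"
        using b by (intro mult_right_mono) (auto simp: D_def)
      also have "12 * D * \<theta>\<^sup>2 = \<theta> * t + - t\<^sup>2 / (64 * D)"
        using D by (simp add: \<theta>_def field_simps power2_eq_square)
      finally show ?thesis by simp
    qed
    finally show ?thesis by (simp add: D_def V_def)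
  qed
qed

lemma uminus_centred_array: "centred_array I (\<lambda>i j. - d i j) b"
proof
  fix i j k l assume "i \<in> I" "j \<in> I" "k \<in> I" "l \<in> I"
  then show "\<bar>- d i k + - d j l - - d i l - - d j k\<bar> \<le> b"
    using increment_bound[of i j k l] by linarith
qed (use finite_index nonempty_index row_sum column_sum in \<open>auto simp: sum_negf\<close>)

lemma two_sided_tail:
  assumes t: "0 < t"
  shows "perm_mean I (\<lambda>p. of_bool (t \<le> \<bar>W p\<bar>))
    \<le> 2 * exp (- t\<^sup>2 / (64 * (perm_mean I (\<lambda>p. (W p)\<^sup>2) + b / 4 * t)))"
proof -
  interpret neg: centred_array I "\<lambda>i j. - d i j" b
    by (rule uminus_centred_array)
  have neg: "neg.W p = - W p" for p
    by (simp add: neg.W_def W_def sum_negf)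
  have "perm_mean I (\<lambda>p. of_bool (t \<le> \<bar>W p\<bar>))
      \<le> perm_mean I (\<lambda>p. of_bool (t \<le> W p) + of_bool (t \<le> - W p))"
    by (intro perm_mean_mono) (auto simp: of_bool_def)
  also have "\<dots> = perm_mean I (\<lambda>p. of_bool (t \<le> W p)) + perm_mean I (\<lambda>p. of_bool (t \<le> neg.W p))"
    by (simp add: perm_mean_add neg)
  finally show ?thesis
    using upper_tail[OF t] neg.upper_tail[OF t] by (simp add: neg)
qed

end

section \<open>Arbitrary arrays\<close>

text \<open>
  Centring changes the permuted sum by a constant, which must be its mean. An exchange increment
  involves four entries of \<open>a\<close>, so \<open>b = 4 * m\<close>.
\<close>

theorem permuted_sum_concentration:
  fixes a :: "'a \<Rightarrow> 'a \<Rightarrow> real"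
  assumes fin: "finite I" and ne: "I \<noteq> {}"
    and bound: "\<And>i j. i \<in> I \<Longrightarrow> j \<in> I \<Longrightarrow> \<bar>a i j\<bar> \<le> m"
    and t: "0 < t"
  defines "X \<equiv> \<lambda>p. \<Sum>i\<in>I. a i (p i)"
  defines "\<mu> \<equiv> perm_mean I X"
  shows "perm_mean I (\<lambda>p. of_bool (t \<le> \<bar>X p - \<mu>\<bar>))
    \<le> 2 * exp (- t\<^sup>2 / (64 * (perm_mean I (\<lambda>p. (X p - \<mu>)\<^sup>2) + m * t)))"
proof -
  define N where "N = real (card I)"
  have N: "0 < N"
    using fin ne by (simp add: N_def card_gt_0_iff)
  define c where "c = (\<Sum>i\<in>I. \<Sum>j\<in>I. a i j) / N"
  define d where "d i j = a i j - (\<Sum>k\<in>I. a i k) / N - (\<Sum>k\<in>I. a k j) / N + c / N" for i j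
  have c': "(\<Sum>j\<in>I. \<Sum>i\<in>I. a i j) = c * N"
    using N by (subst sum.swap) (simp add: c_def)
  have c'': "(\<Sum>i\<in>I. \<Sum>j\<in>I. a i j) = c * N"
    using N by (simp add: c_def)
  interpret centred_array I d "4 * m"
  proof
    show "(\<Sum>j\<in>I. d i j) = 0" for i
      using N by (simp add: d_def sum.distrib sum_subtractf c' flip: sum_divide_distrib N_def)
    show "(\<Sum>i\<in>I. d i j) = 0" for j
      using N by (simp add: d_def sum.distrib sum_subtractf c'' flip: sum_divide_distrib N_def)
    fix i j k l assume "i \<in> I" "j \<in> I" "k \<in> I" "l \<in> I"
    then show "\<bar>d i k + d j l - d i l - d j k\<bar> \<le> 4 * m"
      using bound[of i k] bound[of j l] bound[of i l] bound[of j k]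
      unfolding d_def by linarith
  qed (use fin ne in auto)
  have W: "W p = X p - c" if p: "p permutes I" for p
  proof -
    have "(\<Sum>i\<in>I. \<Sum>k\<in>I. a k (p i)) = c * N"
      using sum_perm[OF p, of "\<lambda>j. \<Sum>k\<in>I. a k j"] c' by simp
    then show ?thesis
      using N by (simp add: W_def X_def d_def sum.distrib sum_subtractf c''
          flip: sum_divide_distrib N_def)
  qed
  have "perm_mean I W = perm_mean I (\<lambda>p. X p - c)"
    using W by (rule perm_mean_cong)
  then have "\<mu> = c"
    by (simp add: perm_mean_W perm_mean_diff perm_mean_const fin \<mu>_def)
  then have "perm_mean I (\<lambda>p. of_bool (t \<le> \<bar>X p - \<mu>\<bar>)) = perm_mean I (\<lambda>p. of_bool (t \<le> \<bar>W p\<bar>))"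
    and "perm_mean I (\<lambda>p. (X p - \<mu>)\<^sup>2) = perm_mean I (\<lambda>p. (W p)\<^sup>2)"
    by (auto intro!: perm_mean_cong simp: W)
  then show ?thesis
    using two_sided_tail[OF t] by simp
qed

section \<open>Uniformly distributed random permutations\<close>

lemma expectation_uniform_random_permutation:
  fixes f :: "(nat \<Rightarrow> nat) \<Rightarrow> real"
  assumes M: "prob_space M" and P: "uniform_random_permutation M n P"
  shows "prob_space.expectation M (\<lambda>\<omega>. f (P \<omega>)) = perm_mean {1..n} f"
proof -
  interpret prob_space M by (rule M)
  let ?K = "{\<pi>. \<pi> permutes {1..n}}"
  let ?A = "\<lambda>\<pi>. {\<omega> \<in> space M. P \<omega> = \<pi>}"
  have prob: "prob (?A \<pi>) = 1 / fact n" if "\<pi> \<in> ?K" for \<pi>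
    using P that by (auto simp: uniform_random_permutation_def)
  have meas: "P \<in> measurable M (count_space ?K)"
    using P by (auto simp: uniform_random_permutation_def)
  have fin: "finite ?K"
    by (simp add: finite_permutations)
  have sets: "?A \<pi> \<in> events" if "\<pi> \<in> ?K" for \<pi>
  proof -
    have "?A \<pi> = P -` {\<pi>} \<inter> space M" by auto
    then show ?thesis
      using measurable_sets[OF meas, of "{\<pi>}"] that by simp
  qed
  have "f (P \<omega>) = (\<Sum>\<pi>\<in>?K. f \<pi> * indicator (?A \<pi>) \<omega>)" if "\<omega> \<in> space M" for \<omega>
  proof -
    have "P \<omega> \<in> ?K"
      using measurable_space[OF meas that] by simp
    moreover have "(\<Sum>\<pi>\<in>?K. f \<pi> * indicator (?A \<pi>) \<omega>) = (\<Sum>\<pi>\<in>?K. if P \<omega> = \<pi> then f \<pi> else 0)"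
      using that by (intro sum.cong) (auto simp: indicator_def)
    ultimately show ?thesis
      using fin by simp
  qed
  then have "expectation (\<lambda>\<omega>. f (P \<omega>)) = expectation (\<lambda>\<omega>. \<Sum>\<pi>\<in>?K. f \<pi> * indicator (?A \<pi>) \<omega>)"
    by (intro Bochner_Integration.integral_cong) auto
  also have "\<dots> = (\<Sum>\<pi>\<in>?K. f \<pi> * prob (?A \<pi>))"
    using sets by (subst Bochner_Integration.integral_sum) (auto simp: emeasure_eq_measure)
  also have "\<dots> = perm_mean {1..n} f"
    using prob by (simp add: perm_mean_def sum_divide_distrib)
  finally show ?thesis .
qed

text \<open>
  The probability, the mean and the variance are averages over all permutations of \<open>{1..n}\<close>,
  so \<open>permuted_sum_concentration\<close> applies with \<open>m\<close> the maximum of the \<open>\<bar>a i j\<bar>\<close>.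
\<close>

theorem corollary2p2:
  fixes M :: "'w measure" and n :: nat and a :: "nat \<Rightarrow> nat \<Rightarrow> real"
    and P :: "'w \<Rightarrow> nat \<Rightarrow> nat" and Z :: "'w \<Rightarrow> real" and t :: real
  assumes "prob_space M"
    and "n \<ge> 1"
    and "uniform_random_permutation M n P"
    and "Z = (\<lambda>\<omega>. \<Sum>i=1..n. a i (P \<omega> i))"
    and "t > 0"
  shows "measure M {\<omega> \<in> space M. \<bar>Z \<omega> - prob_space.expectation M Z\<bar> \<ge> t}
    \<le> 16 * exp (1 / 16) *
       exp (- t\<^sup>2 / (256 * (prob_space.variance M Z
                + Max {\<bar>a i j\<bar> | i j. i \<in> {1..n} \<and> j \<in> {1..n}} * t)))"
proof -
  interpret prob_space M by (rule assms(1))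
  note E = expectation_uniform_random_permutation[OF assms(1,3)]
  define X where "X p = (\<Sum>i=1..n. a i (p i))" for p
  define \<mu> where "\<mu> = perm_mean {1..n} X"
  define m where "m = Max {\<bar>a i j\<bar> | i j. i \<in> {1..n} \<and> j \<in> {1..n}}"
  define V where "V = perm_mean {1..n} (\<lambda>p. (X p - \<mu>)\<^sup>2)"
  have Z: "Z = (\<lambda>\<omega>. X (P \<omega>))"
    by (simp add: assms(4) X_def)
  have mean: "expectation Z = \<mu>"
    unfolding Z \<mu>_def by (rule E)
  have var: "variance Z = V"
    unfolding mean V_def unfolding Z by (rule E)
  have "{\<bar>a i j\<bar> | i j. i \<in> {1..n} \<and> j \<in> {1..n}} = (\<lambda>(i, j). \<bar>a i j\<bar>) ` ({1..n} \<times> {1..n})"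
    by force
  then have bound: "\<bar>a i j\<bar> \<le> m" if "i \<in> {1..n}" "j \<in> {1..n}" for i j
    unfolding m_def using that by (intro Max_ge) auto
  have "0 \<le> m"
    using bound[of 1 1] assms(2) by auto
  moreover have "0 \<le> V"
    unfolding V_def by (rule perm_mean_nonneg) simp
  ultimately have D: "0 \<le> V + m * t"
    using assms(5) by simp
  have "prob {\<omega> \<in> space M. \<bar>Z \<omega> - \<mu>\<bar> \<ge> t} = expectation (indicator {\<omega> \<in> space M. \<bar>Z \<omega> - \<mu>\<bar> \<ge> t})"
    by (simp add: Int_absorb2)
  also have "\<dots> = expectation (\<lambda>\<omega>. of_bool (t \<le> \<bar>X (P \<omega>) - \<mu>\<bar>))"
    by (intro Bochner_Integration.integral_cong) (auto simp: indicator_def Z)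
  also have "\<dots> = perm_mean {1..n} (\<lambda>p. of_bool (t \<le> \<bar>X p - \<mu>\<bar>))"
    by (rule E)
  also have "\<dots> \<le> 2 * exp (- t\<^sup>2 / (64 * (V + m * t)))"
    unfolding X_def \<mu>_def V_def
    by (rule permuted_sum_concentration) (use assms(2,5) bound in auto)
  also have "\<dots> \<le> 16 * exp (1 / 16) * exp (- t\<^sup>2 / (256 * (V + m * t)))"
  proof (intro mult_mono)
    show "(2::real) \<le> 16 * exp (1 / 16)"
      using exp_ge_add_one_self[of "1/16"] by simp
    have "t\<^sup>2 / (V + m * t) / 256 \<le> t\<^sup>2 / (V + m * t) / 64"
      using D by (intro divide_left_mono) auto
    then show "exp (- t\<^sup>2 / (64 * (V + m * t))) \<le> exp (- t\<^sup>2 / (256 * (V + m * t)))"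
      by (simp add: mult.commute)
  qed auto
  finally show ?thesis
    unfolding m_def[symmetric] var unfolding mean .
qed

end
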